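(* For each of the six finite directed graphs $G \in \{4(1,1),\ 4(2),\ 6(1,1),\ 6(2),\ 6(3),\ 8(2,1,1)\}$ (described explicitly in the context), there exist infinitely many parameters $c \in \mathbb{Q}$ such that the directed graph $\mathrm{PrePer}(f_c, \mathbb{Q})$ of rational preperiodic points of $f_c(z) = z^2 + c$ is isomorphic to $G$.
   Context: For $c \in \mathbb{Q}$ let $f_c(z) = z^2 + c$. $\mathrm{PrePer}(f_c,\mathbb{Q})$ is the set of $x \in \mathbb{Q}$ whose forward orbit under iteration of $f_c$ is finite. It is regarded as a directed graph with an arrow $x \to f_c(x)$ for every $x \in \mathrm{PrePer}(f_c,\mathbb{Q})$ (so a fixed point carries a loop). Isomorphism means isomorphism of directed graphs. The notation $N(\ell_1,\ell_2,\ldots)$ denotes a graph with $N$ vertices and directed cycles of lengths $\ell_1,\ell_2,\ldots$. The six graphs are the following (every vertex has exactly one outgoing arrow, and all arrows are listed): - $4(1,1)$: vertices $a,a',b,b'$; arrows $a\to a$, $a'\to a$, $b\to b$, $b'\to b$. - $4(2)$: vertices $x,y,x',y'$; arrows $x\to y$, $y\to x$, $x'\to y$, $y'\to x$. - $6(1,1)$: vertices $a,a',b,b',u,u'$; arrows $a\to a$, $a'\to a$, $b\to b$, $b'\to b$, $u\to a'$, $u'\to a'$. - $6(2)$: vertices $x,y,x',y',u,u'$; arrows $x\to y$, $y\to x$, $x'\to y$, $y'\to x$, $u\to x'$, $u'\to x'$. - $6(3)$: vertices $x,y,z,x',y',z'$; arrows $x\to y$, $y\to z$, $z\to x$, $x'\to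 y$, $y'\to z$, $z'\to x$. - $8(2,1,1)$: the disjoint union of $4(2)$ and $4(1,1)$. *)

theory Defs
  imports Complex_Main "Graph_Theory.Pair_Digraph" "Graph_Theory.Digraph_Isomorphism"
begin

definition quad_map :: "rat \<Rightarrow> rat \<Rightarrow> rat" where
  "quad_map c z = z^2 + c"

definition PrePer :: "('a \<Rightarrow> 'a) \<Rightarrow> 'a set" where
  "PrePer f = {x. finite (range (\<lambda>n. (f ^^ n) x))}"

definition preper_digraph :: "('a \<Rightarrow> 'a) \<Rightarrow> 'a pair_pre_digraph" where
  "preper_digraph f = \<lparr> pverts = PrePer f, parcs = {(x, f x) | x. x \<in> PrePer f} \<rparr>"

datatype vlabel = va | va' | vb | vb' | vx | vx' | vy | vy' | vz | vz' | vu | vu'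

definition graph_4_11 :: "vlabel pair_pre_digraph" where
  "graph_4_11 = \<lparr> pverts = {va, va', vb, vb'},
     parcs = {(va, va), (va', va), (vb, vb), (vb', vb)} \<rparr>"

definition graph_4_2 :: "vlabel pair_pre_digraph" where
  "graph_4_2 = \<lparr> pverts = {vx, vy, vx', vy'},
     parcs = {(vx, vy), (vy, vx), (vx', vy), (vy', vx)} \<rparr>"

definition graph_6_11 :: "vlabel pair_pre_digraph" where
  "graph_6_11 = \<lparr> pverts = {va, va', vb, vb', vu, vu'},
     parcs = {(va, va), (va', va), (vb, vb), (vb', vb), (vu, va'), (vu', va')} \<rparr>"

definition graph_6_2 :: "vlabel pair_pre_digraph" where
  "graph_6_2 = \<lparr> pverts = {vx, vy, vx', vy', vu, vu'},
     parcs = {(vx, vy), (vy, vx), (vx', vy), (vy', vx), (vu, vx'), (vu', vx')} \<rparr>"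

definition graph_6_3 :: "vlabel pair_pre_digraph" where
  "graph_6_3 = \<lparr> pverts = {vx, vy, vz, vx', vy', vz'},
     parcs = {(vx, vy), (vy, vz), (vz, vx), (vx', vy), (vy', vz), (vz', vx)} \<rparr>"

text \<open>The two summands use disjoint sets of labels, so the plain union is their disjoint union.\<close>

lemma pverts_4_2_4_11_disjoint: "pverts graph_4_2 \<inter> pverts graph_4_11 = {}"
  by (simp add: graph_4_2_def graph_4_11_def)

definition graph_8_211 :: "vlabel pair_pre_digraph" where
  "graph_8_211 = \<lparr> pverts = pverts graph_4_2 \<union> pverts graph_4_11,
     parcs = parcs graph_4_2 \<union> parcs graph_4_11 \<rparr>"

end

theory Submission
  imports Defs "HOL-Computational_Algebra.Primes"
begin

text \<open>
  Write \<open>c = a / d\<^sup>2\<close>. Rational preperiodic points then have the form \<open>n / d\<close>, where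
  \<open>n\<close> runs through a set of integers that is closed under \<open>n \<mapsto> (n\<^sup>2 + a) / d\<close> and bounded by the
  archimedean escape radius; in particular \<open>n\<^sup>2 \<equiv> - a (mod d)\<close>. When \<open>c\<close> is very negative, the
  points are moreover confined to two intervals of length about \<open>1\<close> around the two square roots of
  \<open>- c\<close>. If \<open>d\<close> is \<open>1\<close>, \<open>3 ^ k\<close> or \<open>2 * 3 ^ k\<close>, the congruence has only two solutions
  \<open>\<plusminus> n\<^sub>0\<close> modulo \<open>d\<close> (among odd \<open>n\<close> in the last case), which leaves a handful of candidates; on the usual
  one-parameter families for the given graphs such \<open>d\<close> occur for parameters tending to \<open>- \<infinity>\<close>.
  For \<open>6(3)\<close> the denominator is \<open>d = 2 * m * (m + 1)\<close>, which has too many square roots of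
  \<open>- a\<close>; there the image of a candidate must again lie in the two intervals, and the integrality of
  the image decides.
\<close>

section \<open>Numerators of preperiodic points\<close>

lemma PrePer_step_iff: "f x \<in> PrePer f \<longleftrightarrow> x \<in> PrePer f"
proof -
  have "range (\<lambda>n. (f ^^ n) x) = insert x (range (\<lambda>n. (f ^^ n) (f x)))"
    unfolding funpow_swap1[symmetric] by (auto simp: image_iff)
      (metis funpow_0 funpow.simps(2) not0_implies_Suc o_apply)+
  then show ?thesis
    by (simp add: PrePer_def)
qed

text \<open>A strictly increasing height makes the orbit injective. Applied with \<open>abs\<close>
  for archimedean escape and with the denominator of \<open>d * y\<close> for integrality.\<close>

lemma not_PrePer_if_increasing:
  fixes \<phi> :: "'a \<Rightarrow> 'b::linorder"
  assumes "P x" and step: "\<And>y. P y \<Longrightarrow> P (f y) \<and> \<phi> y < \<phi> (f y)"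
  shows "x \<notin> PrePer f"
proof -
  have P: "P ((f ^^ n) x)" for n
    by (induction n) (use assms in auto)
  have "strict_mono (\<lambda>n. \<phi> ((f ^^ n) x))"
    unfolding strict_mono_Suc_iff using step[OF P] by simp
  then have "inj (\<lambda>n. (f ^^ n) x)"
    by (metis (mono_tags, lifting) injI strict_mono_eq)
  then show ?thesis
    by (simp add: PrePer_def range_inj_infinite)
qed

lemma PrePer_if_in_finite_closed:
  assumes "finite S" "f ` S \<subseteq> S" "x \<in> S"
  shows "x \<in> PrePer f"
proof -
  have "(f ^^ n) x \<in> S" for n
    by (induction n) (use assms in auto)
  then show ?thesis
    unfolding PrePer_def using \<open>finite S\<close> by (auto intro: finite_subset)
qed

text \<open>The region \<open>abs y < y^2 + c\<close> is invariant: there \<open>(y^2 + c)^2\<close>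
  exceeds \<open>y^2\<close>, and adding \<open>c\<close> gives the inequality at the image. The
  absolute value grows on it.\<close>

lemma PrePer_quad_map_escape_bound:
  assumes "x \<in> PrePer (quad_map c)"
  shows "x\<^sup>2 + c \<le> \<bar>x\<bar>"
proof (rule ccontr)
  assume "\<not> x\<^sup>2 + c \<le> \<bar>x\<bar>"
  moreover have "\<bar>y\<^sup>2 + c\<bar> < (y\<^sup>2 + c)\<^sup>2 + c \<and> \<bar>y\<bar> < \<bar>y\<^sup>2 + c\<bar>" if "\<bar>y\<bar> < y\<^sup>2 + c" for y :: rat
  proof -
    have "\<bar>y\<bar>\<^sup>2 < (y\<^sup>2 + c)\<^sup>2"
      by (rule power_strict_mono) (use that in auto)
    then show ?thesis
      using that by auto
  qed
  ultimately have "x \<notin> PrePer (quad_map c)"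
    by (intro not_PrePer_if_increasing[where P = "\<lambda>y. \<bar>y\<bar> < y\<^sup>2 + c" and \<phi> = abs])
      (auto simp: quad_map_def)
  with assms show False
    by blast
qed

section \<open>Numerators over a fixed denominator, not necessarily in lowest terms\<close>

definition numers :: "int \<Rightarrow> int \<Rightarrow> int set" where
  "numers a d = {n. of_int n / of_int d \<in> PrePer (quad_map (of_int a / (of_int d)\<^sup>2))}"

text \<open>If \<open>d * y\<close> has denominator \<open>e > 1\<close>, then the denominator of \<open>d * f y\<close> is divisible by \<open>e\<^sup>2\<close>,
  so the denominators along the orbit grow.\<close>

lemma PrePer_quad_map_numer:
  fixes a d :: int
  assumes "d > 0" and x: "x \<in> PrePer (quad_map (of_int a / (of_int d)\<^sup>2))"
  obtains n where "n \<in> numers a d" "x = of_int n / of_int d"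
proof -
  let ?f = "quad_map (of_int a / (of_int d)\<^sup>2)"
  let ?e = "\<lambda>y::rat. snd (quotient_of (of_int d * y))"
  have step: "1 < ?e (?f y) \<and> ?e y < ?e (?f y)" if e1: "1 < ?e y" for y
  proof -
    obtain s e where se: "quotient_of (of_int d * y) = (s, e)"
      by fastforce
    obtain s' e' where se': "quotient_of (of_int d * ?f y) = (s', e')"
      by fastforce
    have e: "e > 1" "coprime s e" "of_int d * y = of_int s / of_int e"
      using e1 se quotient_of_coprime[OF se] quotient_of_div[OF se] by auto
    have e': "e' > 0" "of_int d * ?f y = of_int s' / of_int e'"
      using quotient_of_denom_pos[OF se'] quotient_of_div[OF se'] by auto
    have y: "y = of_int s / (of_int d * of_int e)"
      using e \<open>d > 0\<close> by (simp add: field_simps)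
    have "of_int s' / of_int e' = (of_int (s\<^sup>2 + a * e\<^sup>2) / of_int (d * e\<^sup>2) :: rat)"
      unfolding e'(2)[symmetric] y quad_map_def using \<open>d > 0\<close> e
      by (simp add: field_simps power2_eq_square)
    \<comment> \<open>Cross-multiplying avoids reducing the fraction, whose numerator may share
      factors with \<open>d\<close>. Such cancellation cannot touch \<open>e^2\<close>, which is
      coprime to \<open>s^2 + a * e^2\<close>.\<close>
    then have "of_int (s' * (d * e\<^sup>2)) = (of_int ((s\<^sup>2 + a * e\<^sup>2) * e') :: rat)"
      using \<open>d > 0\<close> e e' by (simp add: divide_simps mult.commute)
    then have "s' * (d * e\<^sup>2) = (s\<^sup>2 + a * e\<^sup>2) * e'"
      by (simp only: of_int_eq_iff)
    then have "e\<^sup>2 dvd (s\<^sup>2 + a * e\<^sup>2) * e'"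
      by (metis dvd_triv_right dvd_mult)
    moreover have "coprime (e\<^sup>2) (s\<^sup>2 + a * e\<^sup>2)"
      using e(2) by (metis add.commute coprime_commute coprime_iff_gcd_eq_1 coprime_power_left_iff
          coprime_power_right_iff gcd_add_mult mult.commute zero_less_numeral)
    ultimately have "e\<^sup>2 dvd e'"
      by (simp add: coprime_dvd_mult_right_iff)
    then have "e\<^sup>2 \<le> e'"
      using e' by (simp add: zdvd_imp_le)
    moreover have "e < e\<^sup>2"
      using e by (simp add: power2_eq_square)
    ultimately show ?thesis
      using se se' e by simp
  qed
  have "\<not> 1 < ?e x"
    using not_PrePer_if_increasing[where P = "\<lambda>y. 1 < ?e y" and \<phi> = ?e, OF _ step] x by blast
  then have "?e x = 1"
    by (smt (verit) quotient_of_denom_pos')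
  then have "of_int d * x = of_int (fst (quotient_of (of_int d * x)))"
    by (metis div_by_1 of_int_1 prod.collapse quotient_of_div)
  then have "x = of_int (fst (quotient_of (of_int d * x))) / of_int d"
    using \<open>d > 0\<close> by (simp add: field_simps)
  then show ?thesis
    using that x unfolding numers_def by (metis mem_Collect_eq)
qed

lemma quad_map_numer:
  fixes a d n n' :: int
  assumes "d > 0" "n\<^sup>2 + a = d * n'"
  shows "quad_map (of_int a / (of_int d)\<^sup>2) (of_int n / of_int d) = of_int n' / of_int d"
proof -
  have "(of_int n)\<^sup>2 + of_int a = (of_int d * of_int n' :: rat)"
    by (metis assms(2) of_int_add of_int_mult of_int_power)
  then show ?thesis
    using \<open>d > 0\<close> by (simp add: quad_map_def power_divide add_divide_distrib[symmetric] power2_eq_square)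
qed

text \<open>Besides closure under the map, this yields \<open>d dvd n^2 + a\<close>, the source of
  all congruence and parity conditions below.\<close>

lemma numers_step:
  assumes "d > 0" "n \<in> numers a d"
  obtains n' where "n' \<in> numers a d" "n\<^sup>2 + a = d * n'"
proof -
  let ?f = "quad_map (of_int a / (of_int d)\<^sup>2)"
  have "?f (of_int n / of_int d) \<in> PrePer ?f"
    using assms by (simp add: numers_def PrePer_step_iff)
  then obtain n' where n': "n' \<in> numers a d" "?f (of_int n / of_int d) = of_int n' / of_int d"
    using PrePer_quad_map_numer[OF \<open>d > 0\<close>] by blast
  have "of_int (n\<^sup>2 + a) = (of_int d)\<^sup>2 * ?f (of_int n / of_int d)"
    using \<open>d > 0\<close> by (simp add: quad_map_def power_divide distrib_left)
  also have "\<dots> = of_int (d * n')"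
    unfolding n'(2) using \<open>d > 0\<close> by (simp add: power2_eq_square)
  finally have "of_int (n\<^sup>2 + a) = (of_int (d * n') :: rat)" .
  then have "n\<^sup>2 + a = d * n'"
    by (simp only: of_int_eq_iff)
  with n' that show ?thesis
    by blast
qed

lemma numers_bound:
  assumes "d > 0" "n \<in> numers a d"
  shows "n\<^sup>2 + a \<le> d * \<bar>n\<bar>"
proof -
  have "(of_int n / of_int d)\<^sup>2 + of_int a / (of_int d)\<^sup>2 \<le> \<bar>of_int n / of_int d :: rat\<bar>"
    using PrePer_quad_map_escape_bound assms(2) unfolding numers_def by blast
  then have "(of_int d)\<^sup>2 * ((of_int n / of_int d)\<^sup>2 + of_int a / (of_int d)\<^sup>2)
      \<le> (of_int d)\<^sup>2 * \<bar>of_int n / of_int d :: rat\<bar>"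
    by (rule mult_left_mono) simp
  moreover have "(of_int d)\<^sup>2 * ((of_int n / of_int d)\<^sup>2 + of_int a / (of_int d)\<^sup>2) = (of_int (n\<^sup>2 + a) :: rat)"
    using \<open>d > 0\<close> by (simp add: power_divide distrib_left)
  moreover have "(of_int d)\<^sup>2 * \<bar>of_int n / of_int d :: rat\<bar> = of_int (d * \<bar>n\<bar>)"
    using \<open>d > 0\<close> by (simp add: power2_eq_square)
  ultimately have "(of_int (n\<^sup>2 + a) :: rat) \<le> of_int (d * \<bar>n\<bar>)"
    by simp
  then show ?thesis
    by (simp only: of_int_le_iff)
qed

text \<open>The map is even, so a point and its negative share their image. This permits working
  with absolute values only.\<close>

lemma numers_abs:
  assumes "n \<in> numers a d"
  shows "\<bar>n\<bar> \<in> numers a d"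
proof -
  have "quad_map c \<bar>x\<bar> = quad_map c x" for c x
    by (simp add: quad_map_def)
  then have "\<bar>x\<bar> \<in> PrePer (quad_map c) \<longleftrightarrow> x \<in> PrePer (quad_map c)" for c x
    by (metis PrePer_step_iff)
  then have "- x \<in> PrePer (quad_map c) \<longleftrightarrow> x \<in> PrePer (quad_map c)" for c x
    by (metis abs_minus_cancel)
  then show ?thesis
    using assms by (auto simp: numers_def abs_if)
qed

section \<open>From a labelling by numerators to digraph isomorphisms and infinite sets of
  parameters\<close>

lemma digraph_iso_preper_digraph:
  assumes bij: "bij_betw h (pverts G) (PrePer f)"
    and arcs: "\<And>u v. (u, v) \<in> parcs G \<Longrightarrow> u \<in> pverts G \<and> v \<in> pverts G \<and> f (h u) = h v"
    and out: "\<And>u. u \<in> pverts G \<Longrightarrow> \<exists>v. (u, v) \<in> parcs G"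
  shows "digraph_iso (with_proj (preper_digraph f)) (with_proj G)"
proof -
  \<comment> \<open>The isomorphism has to run from the preperiodic digraph to \<open>G\<close>,
    hence the inverse of \<open>h\<close>.\<close>
  define k where "k = the_inv_into (pverts G) h"
  have inj: "inj_on h (pverts G)" and img: "h ` pverts G = PrePer f"
    using bij by (auto simp: bij_betw_def)
  have kh: "k (h u) = u" if "u \<in> pverts G" for u
    unfolding k_def using inj that by (rule the_inv_into_f_f)
  have "bij_betw k (PrePer f) (pverts G)"
    unfolding k_def using bij by (rule bij_betw_the_inv_into)
  then have injk: "inj_on k (PrePer f)" and imgk: "k ` PrePer f = pverts G"
    by (auto simp: bij_betw_def)
  \<comment> \<open>Arcs of \<open>G\<close> follow the function \<open>f\<close>, so a vertex has
    at most one outgoing arc; \<open>out\<close> provides one. The arc sets therefore agree in both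
    directions.\<close>
  have parcs: "map_prod k k ` {(x, f x) | x. x \<in> PrePer f} = parcs G" (is "?L = _")
  proof (intro equalityI subsetI)
    fix e assume "e \<in> ?L"
    then obtain u where u: "u \<in> pverts G" "e = (k (h u), k (f (h u)))"
      unfolding img[symmetric] by auto
    then obtain v where "(u, v) \<in> parcs G"
      using out by blast
    then show "e \<in> parcs G"
      using arcs u kh by metis
  next
    fix e assume e: "e \<in> parcs G"
    then obtain u v where uv: "e = (u, v)" by fastforce
    then have "e = map_prod k k (h u, f (h u))" "h u \<in> PrePer f"
      using arcs[of u v] e kh[of u] kh[of v] img by auto
    then show "e \<in> ?L"
      by blast
  qed
  let ?hom = "\<lparr>iso_verts = k, iso_arcs = map_prod k k, iso_head = snd, iso_tail = fst\<rparr>"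
  have "inj_on (map_prod k k) {(x, f x) | x. x \<in> PrePer f}"
    using injk by (auto simp: inj_on_def)
  moreover have "wf_digraph (with_proj (preper_digraph f))"
    by unfold_locales (auto simp: preper_digraph_def PrePer_step_iff)
  ultimately have "pre_digraph.digraph_isomorphism (with_proj (preper_digraph f)) ?hom"
    using injk by (auto simp: pre_digraph.digraph_isomorphism_def preper_digraph_def)
  moreover have "with_proj G = app_iso ?hom (with_proj (preper_digraph f))"
    using parcs imgk by (simp add: app_iso_def preper_digraph_def with_proj_def)
  ultimately show ?thesis
    unfolding digraph_iso_def by blast
qed

text \<open>A finite set closed under the map is preperiodic, so the labels are preperiodic for
  free. The hard input is \<open>sub\<close>: no other numerators exist.\<close>

lemma digraph_iso_preper_quad_map:
  fixes h :: "'v \<Rightarrow> int"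
  assumes "d > 0" and fin: "finite (pverts G)" and inj: "inj_on h (pverts G)"
    and arcs: "\<And>u v. (u, v) \<in> parcs G \<Longrightarrow> u \<in> pverts G \<and> v \<in> pverts G \<and> (h u)\<^sup>2 + a = d * h v"
    and out: "\<And>u. u \<in> pverts G \<Longrightarrow> \<exists>v. (u, v) \<in> parcs G"
    and sub: "numers a d \<subseteq> h ` pverts G"
  shows "digraph_iso (with_proj (preper_digraph (quad_map (of_int a / (of_int d)\<^sup>2)))) (with_proj G)"
proof (rule digraph_iso_preper_digraph)
  let ?f = "quad_map (of_int a / (of_int d)\<^sup>2)"
  let ?g = "\<lambda>u. of_int (h u) / of_int d :: rat"
  have step: "?f (?g u) = ?g v" if "(u, v) \<in> parcs G" for u v
    using quad_map_numer[OF \<open>d > 0\<close>] arcs[OF that] by blast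
  show "u \<in> pverts G \<and> v \<in> pverts G \<and> ?f (?g u) = ?g v" if "(u, v) \<in> parcs G" for u v
    using arcs step that by blast
  show "\<exists>v. (u, v) \<in> parcs G" if "u \<in> pverts G" for u
    using out that .
  have "?f ` ?g ` pverts G \<subseteq> ?g ` pverts G"
    using out step arcs by fastforce
  then have "?g ` pverts G \<subseteq> PrePer ?f"
    using PrePer_if_in_finite_closed[of "?g ` pverts G" ?f] fin by blast
  moreover have "PrePer ?f \<subseteq> ?g ` pverts G"
    using sub by (fastforce elim: PrePer_quad_map_numer[OF \<open>d > 0\<close>])
  moreover have "inj_on ?g (pverts G)"
    using inj \<open>d > 0\<close> by (auto simp: inj_on_def)
  ultimately show "bij_betw ?g (pverts G) (PrePer ?f)"
    by (auto simp: bij_betw_def)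
qed

text \<open>A finite set of rationals is bounded below, while the hypothesis supplies parameters
  below every \<open>- k\<close>.\<close>

lemma infinite_params:
  fixes P :: "rat \<Rightarrow> bool" and k\<^sub>0 :: nat
  assumes "\<And>k. k \<ge> k\<^sub>0 \<Longrightarrow> \<exists>a d::int. d > 0 \<and> a < - int k * d\<^sup>2 \<and> P (of_int a / (of_int d)\<^sup>2)"
  shows "infinite {c. P c}"
proof
  assume "finite {c. P c}"
  then obtain b where b: "\<And>c. P c \<Longrightarrow> b \<le> c"
    by (meson bdd_below_finite bdd_below.E mem_Collect_eq)
  obtain k where "- b < of_nat k"
    using reals_Archimedean2 by blast
  then have "- b < of_nat (max k k\<^sub>0)"
    by (metis max.cobounded1 of_nat_le_iff order_less_le_trans)
  moreover obtain a d :: int where ad: "d > 0" "a < - int (max k k\<^sub>0) * d\<^sup>2" "P (of_int a / (of_int d)\<^sup>2)"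
    using assms by (meson max.cobounded2)
  have "(of_int a :: rat) < of_int (- int (max k k\<^sub>0) * d\<^sup>2)"
    using ad(2) of_int_less_iff by blast
  then have "(of_int a :: rat) < - of_nat (max k k\<^sub>0) * (of_int d)\<^sup>2"
    by simp
  then have "of_int a / (of_int d)\<^sup>2 < (- of_nat (max k k\<^sub>0) :: rat)"
    using ad(1) by (simp add: divide_less_eq)
  ultimately show False
    using b[OF ad(3)] by linarith
qed

section \<open>Locating numerators by congruence and size\<close>

lemma square_congruent_mod_prime_power:
  fixes m n p :: int
  assumes "prime p" "odd p" "\<not> p dvd m" "p ^ k dvd n\<^sup>2 - m\<^sup>2"
  shows "p ^ k dvd n - m \<or> p ^ k dvd n + m"
proof -
  have dvd: "p ^ k dvd (n - m) * (n + m)"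
    using assms(4) by (simp add: power2_eq_square algebra_simps)
  have "\<not> p dvd 2"
    using prime_ge_2_int[OF assms(1)] assms(2) zdvd_imp_le[of p 2] by force
  then have "\<not> p dvd 2 * m"
    using assms(1,3) prime_dvd_mult_iff by blast
  \<comment> \<open>The two factors differ by \<open>2 * m\<close>, so \<open>p\<close> divides at
    most one of them, and that one absorbs the whole power \<open>p ^ k\<close>.\<close>
  then have "\<not> (p dvd n - m \<and> p dvd n + m)"
    using dvd_diff[of p "n + m" "n - m"] by auto
  then have "coprime (p ^ k) (n - m) \<or> coprime (p ^ k) (n + m)"
    using prime_imp_coprime[OF assms(1)] by auto
  then show ?thesis
    using dvd by (auto simp: coprime_dvd_mult_right_iff coprime_dvd_mult_left_iff)
qed

lemma numers_less:
  assumes "d > 0" "n \<in> numers a d" and M: "d * M < M\<^sup>2 + a" "d \<le> 2 * M"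
  shows "\<bar>n\<bar> < M"
proof (rule ccontr)
  assume "\<not> \<bar>n\<bar> < M"
  \<comment> \<open>This product is the increment of \<open>t^2 - d * t\<close> from
    \<open>M\<close> to \<open>abs n\<close>; beyond \<open>d / 2\<close> that function increases,
    so escape at \<open>M\<close> persists.\<close>
  then have "0 \<le> (\<bar>n\<bar> - M) * (\<bar>n\<bar> + M - d)"
    using M(2) by (intro mult_nonneg_nonneg) auto
  then have "M\<^sup>2 - d * M \<le> \<bar>n\<bar>\<^sup>2 - d * \<bar>n\<bar>"
    by (simp add: power2_eq_square algebra_simps del: abs_mult_self_eq)
  with numers_bound[OF assms(1,2)] M(1) show False
    by simp
qed

text \<open>Here \<open>m\<close> is a known square root of \<open>- a\<close> modulo
  \<open>p ^ k\<close>; every numerator is another one.\<close>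

lemma numers_cong:
  assumes "d > 0" "n \<in> numers a d" "prime p" "odd p" "\<not> p dvd m" "p ^ k dvd d" "p ^ k dvd m\<^sup>2 + a"
  shows "p ^ k dvd n - m \<or> p ^ k dvd n + m"
proof -
  obtain n' where "n\<^sup>2 + a = d * n'"
    using numers_step[OF assms(1,2)] by blast
  then have "p ^ k dvd n\<^sup>2 + a"
    using assms(6) by simp
  with assms(7) have "p ^ k dvd (n\<^sup>2 + a) - (m\<^sup>2 + a)"
    by (rule dvd_diff[rotated])
  then show ?thesis
    using square_congruent_mod_prime_power[OF assms(3-5)] by simp
qed

section \<open>The parameter families\<close>

lemma numers_4_11:
  fixes b :: int
  assumes "b \<ge> 3" "n \<in> numers (b - b\<^sup>2) 1"
  shows "\<bar>n\<bar> \<in> {b, b - 1}"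
proof -
  have le: "\<bar>i\<bar> \<le> b" if "i \<in> numers (b - b\<^sup>2) 1" for i
    using numers_less[of 1 i "b - b\<^sup>2" "b + 1"] that \<open>b \<ge> 3\<close> by (simp add: power2_eq_square algebra_simps)
  obtain n' where n': "n' \<in> numers (b - b\<^sup>2) 1" "n\<^sup>2 + (b - b\<^sup>2) = n'"
    using numers_step[of 1 n "b - b\<^sup>2"] assms(2) by auto
  \<comment> \<open>The image is at least \<open>- b\<close>, so \<open>n^2\<close> is at least
    \<open>b^2 - 2 * b\<close>, which exceeds \<open>(b - 2)^2\<close> because
    \<open>b > 2\<close>.\<close>
  have "(b - 2)\<^sup>2 < \<bar>n\<bar>\<^sup>2"
    using n'(2) le[OF n'(1)] \<open>b \<ge> 3\<close> by (simp add: power2_eq_square algebra_simps)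
  then have "b - 2 < \<bar>n\<bar>"
    by (rule power2_less_imp_less) simp
  with le[OF assms(2)] show ?thesis
    by auto
qed

lemma numers_4_2:
  fixes t :: int
  assumes "t \<ge> 1" "n \<in> numers (- (t\<^sup>2 + t + 1)) 1"
  shows "\<bar>n\<bar> \<in> {t, t + 1}"
proof -
  let ?a = "- (t\<^sup>2 + t + 1)"
  have le: "\<bar>i\<bar> \<le> t + 1" if "i \<in> numers ?a 1" for i
    using numers_less[of 1 i ?a "t + 2"] that \<open>t \<ge> 1\<close> by (simp add: power2_eq_square algebra_simps)
  obtain n' where n': "n' \<in> numers ?a 1" "n\<^sup>2 + ?a = n'"
    using numers_step[of 1 n ?a] assms(2) by auto
  \<comment> \<open>The lower bound \<open>- (t + 1)\<close> on the image gives exactly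
    \<open>t^2\<close>.\<close>
  have "t\<^sup>2 \<le> \<bar>n\<bar>\<^sup>2"
    using n'(2) le[OF n'(1)] by simp
  then have "t \<le> \<bar>n\<bar>"
    by (rule power2_le_imp_le) simp
  with le[OF assms(2)] show ?thesis
    by auto
qed

text \<open>\<open>c = \<beta> - \<beta>\<^sup>2\<close> with fixed point \<open>\<beta> = (q + 1 / q) / 2 = B / q\<close>, so that \<open>\<beta>\<^sup>2 - 1\<close> is a square.\<close>

lemma numers_6_11:
  fixes q B :: int
  assumes q: "q = 3 ^ k" "q \<ge> 9" and B: "2 * B = q\<^sup>2 + 1" and "n \<in> numers (q * B - B\<^sup>2) q"
  shows "\<bar>n\<bar> \<in> {B, B - q, B - 1}"
proof -
  let ?N = "numers (q * B - B\<^sup>2) q"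
  have "9 * q \<le> q\<^sup>2"
    using q(2) by (simp add: power2_eq_square)
  then have qB: "4 * q < B"
    using B q(2) by linarith
  have "3 dvd q"
    using q by (cases k) auto
  then have "3 dvd q\<^sup>2"
    by (simp add: power2_eq_square)
  then have B3: "\<not> 3 dvd B"
    using B by presburger
  have le: "\<bar>i\<bar> \<le> B" if "i \<in> ?N" for i
  proof -
    have "\<bar>i\<bar> < B + 1"
      by (rule numers_less[OF _ that]) (use B q(2) qB \<open>9 * q \<le> q\<^sup>2\<close> in \<open>auto simp: power2_eq_square algebra_simps\<close>)
    then show ?thesis by simp
  qed
  have candidates: "\<bar>i\<bar> \<in> {B, B - q, B - 1, B - 1 - q}" if i: "i \<in> ?N" for i
  proof -
    obtain i' where i': "i' \<in> ?N" "i\<^sup>2 + (q * B - B\<^sup>2) = q * i'"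
      using numers_step i q(2) by (metis less_le_trans zero_less_numeral)
    have "q * - B \<le> q * i'"
      by (rule mult_left_mono) (use le[OF i'(1)] q(2) in auto)
    moreover have "q * (2 * q) < q * B"
      by (rule mult_strict_left_mono) (use qB q(2) in auto)
    \<comment> \<open>The image is at least \<open>- B\<close>, so \<open>i^2\<close> is at least
      \<open>B^2 - 2 * q * B\<close>, exceeding \<open>(B - 2 * q)^2\<close> by
      \<open>2 * q * (B - 2 * q)\<close>.\<close>
    ultimately have "(B - 2 * q)\<^sup>2 < \<bar>i\<bar>\<^sup>2"
      using i'(2) by (simp add: power2_eq_square algebra_simps)
    then have gt: "B - 2 * q < \<bar>i\<bar>"
      by (rule power2_less_imp_less) simp
    have "q dvd \<bar>i\<bar> - B \<or> q dvd \<bar>i\<bar> + B"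
      unfolding q(1) by (rule numers_cong[OF _ numers_abs[OF i] _ _ B3])
        (use q in simp_all)
    then show ?thesis
    proof
      assume "q dvd \<bar>i\<bar> - B"
      then obtain l where l: "\<bar>i\<bar> - B = q * l" ..
      then have "q * - 2 < q * l" "q * l < q * 1"
        using gt le[OF i] q(2) by linarith+
      then have "- 2 < l" "l < 1"
        using q(2) by (simp_all only: mult_less_cancel_left_pos)
      then have "l = - 1 \<or> l = 0"
        by linarith
      then show ?thesis
        using l by auto
    next
      \<comment> \<open>Since \<open>q^2 = 2 * B - 1\<close>, the class of \<open>- B\<close>
        contributes \<open>q^2 - B = B - 1\<close> and the value lower by \<open>q\<close>.\<close>
      assume "q dvd \<bar>i\<bar> + B"
      then obtain l where l: "\<bar>i\<bar> + B = q * l" ..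
      then have "q * (q - 2) < q * l" "q * l < q * (q + 1)"
        using gt le[OF i] q(2) B by (auto simp: power2_eq_square algebra_simps)
      then have "q - 2 < l" "l < q + 1"
        using q(2) by (simp_all only: mult_less_cancel_left_pos)
      then have "l = q - 1 \<or> l = q"
        by linarith
      then show ?thesis
        using l B by (auto simp: power2_eq_square algebra_simps)
    qed
  qed
  \<comment> \<open>The spurious candidate would map to \<open>2 - B\<close>, and
    \<open>B - 2\<close> is not itself a candidate.\<close>
  have "\<bar>n\<bar> \<noteq> B - 1 - q"
  proof
    assume n: "\<bar>n\<bar> = B - 1 - q"
    obtain n' where n': "n' \<in> ?N" "\<bar>n\<bar>\<^sup>2 + (q * B - B\<^sup>2) = q * n'"
      using numers_step assms(4) q(2) by (metis less_le_trans power2_abs zero_less_numeral)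
    have "\<bar>n\<bar>\<^sup>2 + (q * B - B\<^sup>2) = q\<^sup>2 + 2 * q + 1 - q * B - 2 * B"
      unfolding n by (simp add: power2_eq_square algebra_simps)
    also have "\<dots> = q * (2 - B)"
      using B by (simp add: power2_eq_square algebra_simps)
    finally have "n' = 2 - B"
      using n'(2) q(2) by simp
    then have "B - 2 \<in> {B, B - q, B - 1, B - 1 - q}"
      using candidates[OF n'(1)] qB q(2) by simp
    then show False
      using q(2) by simp
  qed
  with candidates[OF assms(4)] show ?thesis
    by simp
qed

text \<open>\<open>c = - 1 - \<tau> - \<tau>\<^sup>2\<close> with \<open>\<tau> = (q - 1 / q) / 2 = T / q\<close> of period 2, so that \<open>\<tau>\<^sup>2 + 1\<close> is a square.\<close>

lemma numers_6_2:
  fixes q T :: int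
  assumes q: "q = 3 ^ k" "q \<ge> 9" and T: "2 * T = q\<^sup>2 - 1" and n: "n \<in> numers (- (q\<^sup>2 + q * T + T\<^sup>2)) q"
  shows "\<bar>n\<bar> \<in> {T, T + q, T + 1}"
proof -
  let ?a = "- (q\<^sup>2 + q * T + T\<^sup>2)"
  let ?N = "numers ?a q"
  have qq: "9 * q \<le> q\<^sup>2"
    using q(2) by (simp add: power2_eq_square)
  then have "T \<ge> 0"
    using T q(2) by linarith
  have "3 dvd q"
    using q by (cases k) auto
  then have "3 dvd q\<^sup>2"
    by (simp add: power2_eq_square)
  then have T3: "\<not> 3 dvd T"
    using T by presburger
  have le: "\<bar>i\<bar> \<le> T + q" if "i \<in> ?N" for i
  proof -
    have "\<bar>i\<bar> < T + q + 1"
      by (rule numers_less[OF _ that]) (use T \<open>T \<ge> 0\<close> q(2) qq in \<open>auto simp: power2_eq_square algebra_simps\<close>)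
    then show ?thesis by simp
  qed
  obtain n' where n': "n' \<in> ?N" "n\<^sup>2 + ?a = q * n'"
    using numers_step n q(2) by (metis less_le_trans zero_less_numeral)
  have "q * - (T + q) \<le> q * n'"
    by (rule mult_left_mono) (use le[OF n'(1)] q(2) in auto)
  then have "T\<^sup>2 \<le> \<bar>n\<bar>\<^sup>2"
    using n'(2) by (simp add: power2_eq_square algebra_simps)
  then have ge: "T \<le> \<bar>n\<bar>"
    by (rule power2_le_imp_le) simp
  have dvd: "q dvd T\<^sup>2 + ?a"
    by (simp add: power2_eq_square)
  have "q dvd \<bar>n\<bar> - T \<or> q dvd \<bar>n\<bar> + T"
    unfolding q(1) by (rule numers_cong[OF _ numers_abs[OF n] _ _ T3])
        (use q dvd in simp_all)
  then show ?thesis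
  proof
    assume "q dvd \<bar>n\<bar> - T"
    then obtain l where l: "\<bar>n\<bar> - T = q * l" ..
    then have "q * (- 1) < q * l" "q * l < q * 2"
      using l ge le[OF n] q(2) by linarith+
    then have "- 1 < l" "l < 2"
      using q(2) by (simp_all only: mult_less_cancel_left_pos)
    then have "l = 0 \<or> l = 1"
      by linarith
    then show ?thesis
      using l by auto
  next
    \<comment> \<open>In the class of \<open>- T\<close> only \<open>q^2 - T = T + 1\<close> lies
      between \<open>T\<close> and \<open>T + q\<close>.\<close>
    assume "q dvd \<bar>n\<bar> + T"
    then obtain l where l: "\<bar>n\<bar> + T = q * l" ..
    then have "q * (q - 1) < q * l" "q * l < q * (q + 1)"
      using ge le[OF n] q(2) T by (auto simp: power2_eq_square algebra_simps)
    then have "q - 1 < l" "l < q + 1"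
      using q(2) by (simp_all only: mult_less_cancel_left_pos)
    then have "l = q"
      by linarith
    then show ?thesis
      using l T by (auto simp: power2_eq_square algebra_simps)
  qed
qed

text \<open>\<open>c = 1 / 4 - \<rho>\<^sup>2 = - 3 / 4 - \<sigma>\<^sup>2\<close> with \<open>\<rho> = (q + 1 / q) / 2\<close>, \<open>\<sigma> = (q - 1 / q) / 2\<close>; the fixed point \<open>1 / 2 + \<rho>\<close> is \<open>B / (2 * q)\<close>.\<close>

lemma numers_8_211:
  fixes q B :: int
  assumes q: "q = 3 ^ k" "q \<ge> 9" and B: "B = q\<^sup>2 + q + 1" and n: "n \<in> numers (2 * q * B - B\<^sup>2) (2 * q)"
  shows "\<bar>n\<bar> \<in> {B, B - 2 * q, B - 2, B - 2 - 2 * q}"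
proof -
  let ?a = "2 * q * B - B\<^sup>2"
  let ?N = "numers ?a (2 * q)"
  have qq: "9 * q \<le> q\<^sup>2"
    using q(2) by (simp add: power2_eq_square)
  then have qB: "4 * q < B"
    using B q(2) by linarith
  have "3 dvd q"
    using q by (cases k) auto
  then have "3 dvd q\<^sup>2"
    by (simp add: power2_eq_square)
  then have B3: "\<not> 3 dvd B"
    using B \<open>3 dvd q\<close> by presburger
  have "odd q"
    by (simp add: q(1))
  then have "odd B"
    by (simp add: B)
  have le: "\<bar>i\<bar> \<le> B" if "i \<in> ?N" for i
  proof -
    have "\<bar>i\<bar> < B + 1"
      by (rule numers_less[OF _ that]) (use B q(2) qB qq in \<open>auto simp: power2_eq_square algebra_simps\<close>)
    then show ?thesis by simp
  qed
  obtain n' where n': "n' \<in> ?N" "n\<^sup>2 + ?a = 2 * q * n'"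
    using numers_step[OF _ n] q(2) by auto
  \<comment> \<open>Parity supplies the factor 2 of the denominator \<open>2 * q\<close>; the
    congruence modulo \<open>3 ^ k\<close> sees only \<open>q\<close>.\<close>
  then have "n\<^sup>2 = B\<^sup>2 + 2 * (q * (n' - B))"
    by (simp add: algebra_simps)
  then have "odd (n\<^sup>2)"
    using \<open>odd B\<close> by simp
  then have "odd \<bar>n\<bar>"
    by simp
  have "q * - B \<le> q * n'"
    by (rule mult_left_mono) (use le[OF n'(1)] q(2) in auto)
  moreover have "q * (4 * q) < q * B"
    by (rule mult_strict_left_mono) (use qB q(2) in auto)
  ultimately have "(B - 4 * q)\<^sup>2 < \<bar>n\<bar>\<^sup>2"
    using n'(2) by (simp add: power2_eq_square algebra_simps)
  then have gt: "B - 4 * q < \<bar>n\<bar>"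
    by (rule power2_less_imp_less) simp
  have "q dvd \<bar>n\<bar> - B \<or> q dvd \<bar>n\<bar> + B"
    unfolding q(1) by (rule numers_cong[OF _ numers_abs[OF n] _ _ B3])
        (use q in simp_all)
  then show ?thesis
  proof
    assume "q dvd \<bar>n\<bar> - B"
    then obtain l where l: "\<bar>n\<bar> - B = q * l" ..
    then have "even l"
      using \<open>odd q\<close> \<open>odd B\<close> \<open>odd \<bar>n\<bar>\<close> by (metis even_diff even_mult_iff odd_even_add)
    have "q * - 4 < q * l" "q * l < q * 1"
      using l gt le[OF n] q(2) by linarith+
    then have "- 4 < l" "l < 1"
      using q(2) by (simp_all only: mult_less_cancel_left_pos)
    then have "l = 0 \<or> l = - 2"
      using \<open>even l\<close> by presburger
    then show ?thesis
      using l by auto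
  next
    \<comment> \<open>The class of \<open>- B\<close> gives
      \<open>2 * q^2 - B = B - 2 - 2 * q\<close> and
      \<open>2 * q^2 + 2 * q - B = B - 2\<close>.\<close>
    assume "q dvd \<bar>n\<bar> + B"
    then obtain l where l: "\<bar>n\<bar> + B = q * l" ..
    then have "even (l - 2 * q)"
      using \<open>odd q\<close> \<open>odd B\<close> \<open>odd \<bar>n\<bar>\<close> by (auto dest: arg_cong[where f = even])
    have "q * (2 * q - 2) < q * l" "q * l < q * (2 * q + 3)"
      using l gt le[OF n] q(2) by (auto simp: B power2_eq_square algebra_simps)
    then have "2 * q - 2 < l" "l < 2 * q + 3"
      using q(2) by (simp_all only: mult_less_cancel_left_pos)
    then have "l = 2 * q \<or> l = 2 * q + 2"
      using \<open>even (l - 2 * q)\<close> by presburger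
    then show ?thesis
      using l by (auto simp: B power2_eq_square algebra_simps)
  qed
qed

text \<open>The standard parametrisation of quadratic polynomials with a rational 3-cycle, here \<open>n\<^sub>1 \<mapsto> n\<^sub>2 \<mapsto> - (n\<^sub>1 + 2 * m) \<mapsto> n\<^sub>1\<close>, at an integral value \<open>m\<close> of its parameter.\<close>

lemma numers_6_3:
  fixes m w :: int
  assumes m: "m \<ge> 10"
  defines "w \<equiv> m * (m + 1)" and "n\<^sub>2 \<equiv> m ^ 3 - m - 1"
  defines "n\<^sub>1 \<equiv> n\<^sub>2 + 2 * m\<^sup>2 + 2 * m + 2"
  defines "a \<equiv> - (2 * w * (n\<^sub>1 + 2 * m) + n\<^sub>2\<^sup>2)"
  assumes n: "n \<in> numers a (2 * w)"
  shows "\<bar>n\<bar> \<in> {n\<^sub>1, n\<^sub>2, n\<^sub>1 + 2 * m}"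
proof -
  let ?N = "numers a (2 * w)"
  have "10 * m \<le> m * m"
    using m by simp
  then have w: "w \<ge> 11 * m"
    by (simp add: w_def algebra_simps)
  have "even w"
    by (simp add: w_def)
  have n2w: "n\<^sub>2 = w * (m - 1) - 1" and n1w: "n\<^sub>1 = w * (m + 1) + 1"
    by (simp_all add: n\<^sub>1_def n\<^sub>2_def w_def power2_eq_square power3_eq_cube algebra_simps)
  have n1: "n\<^sub>1\<^sup>2 + a = 2 * w * n\<^sub>2"
    by (simp add: a_def n\<^sub>1_def n\<^sub>2_def w_def power2_eq_square power3_eq_cube algebra_simps)
  have "odd n\<^sub>2" "odd n\<^sub>1"
    using \<open>even w\<close> by (simp_all add: n2w n1w)
  have "w * 9 \<le> w * (m - 1)"
    by (rule mult_left_mono) (use m w in auto)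
  then have n2_pos: "n\<^sub>2 > 8 * w"
    using n2w m w by linarith
  have n21: "n\<^sub>2 < n\<^sub>1"
    unfolding n\<^sub>1_def using m zero_le_power2[of m] by linarith
  have step: "\<exists>i'. i' \<in> ?N \<and> \<bar>i\<bar>\<^sup>2 + a = 2 * w * i' \<and> odd \<bar>i\<bar>" if i: "i \<in> ?N" for i
  proof -
    obtain i' where i': "i' \<in> ?N" "i\<^sup>2 + a = 2 * w * i'"
      using numers_step[OF _ i] w m by auto
    then have "i\<^sup>2 = n\<^sub>2\<^sup>2 + 2 * (w * (i' + n\<^sub>1 + 2 * m))"
      by (simp add: a_def algebra_simps)
    then have "odd (i\<^sup>2)"
      using \<open>odd n\<^sub>2\<close> by simp
    with i' show ?thesis
      by auto
  qed
  have le: "\<bar>i\<bar> \<le> n\<^sub>1 + 2 * m" if "i \<in> ?N" for i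
  proof -
    \<comment> \<open>The escape bound still admits \<open>n\<^sub>1 + 2 * m + 1\<close>, which
      parity then removes.\<close>
    have "\<bar>i\<bar> < n\<^sub>1 + 2 * m + 2"
    proof (rule numers_less[OF _ that])
      have "(n\<^sub>1 + 2 * m + 2)\<^sup>2 + a - 2 * w * (n\<^sub>1 + 2 * m + 2) = 8 * m + 8"
        by (simp add: a_def n\<^sub>1_def n\<^sub>2_def w_def power2_eq_square power3_eq_cube algebra_simps)
      then show "2 * w * (n\<^sub>1 + 2 * m + 2) < (n\<^sub>1 + 2 * m + 2)\<^sup>2 + a"
        using m by linarith
    qed (use w m n2_pos n21 in auto)
    moreover have "odd \<bar>i\<bar>"
      using step[OF that] by blast
    ultimately show ?thesis
      using \<open>odd n\<^sub>1\<close> by presburger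
  qed
  have ge: "n\<^sub>2 \<le> \<bar>i\<bar>" if i: "i \<in> ?N" for i
  proof -
    obtain i' where i': "i' \<in> ?N" "\<bar>i\<bar>\<^sup>2 + a = 2 * w * i'"
      using step[OF i] by blast
    have "w * - (n\<^sub>1 + 2 * m) \<le> w * i'"
      by (rule mult_left_mono) (use le[OF i'(1)] w m in auto)
    then have "n\<^sub>2\<^sup>2 \<le> \<bar>i\<bar>\<^sup>2"
      using i'(2) by (simp add: a_def algebra_simps)
    then show ?thesis
      by (rule power2_le_imp_le) simp
  qed
  have pos: "\<bar>i\<bar> \<in> {n\<^sub>1, n\<^sub>1 + 2 * m}"
    if i: "i \<in> ?N" and i': "i' \<in> ?N" "\<bar>i\<bar>\<^sup>2 + a = 2 * w * i'" "i' \<ge> 0" for i i'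
  proof -
    have "w * n\<^sub>2 \<le> w * i'"
      by (rule mult_left_mono) (use ge[OF i'(1)] i'(3) w m in auto)
    then have "n\<^sub>1\<^sup>2 \<le> \<bar>i\<bar>\<^sup>2"
      using i'(2) n1 by simp
    then have "n\<^sub>1 \<le> \<bar>i\<bar>"
      by (rule power2_le_imp_le) simp
    moreover have "even (\<bar>i\<bar> - n\<^sub>1)"
      using step[OF i] \<open>odd n\<^sub>1\<close> by auto
    then obtain j where "\<bar>i\<bar> - n\<^sub>1 = 2 * j" ..
    ultimately have j: "\<bar>i\<bar> = n\<^sub>1 + 2 * j" "0 \<le> j" "j \<le> m"
      using le[OF i] by auto
    have "even (i' - n\<^sub>2)"
      using step[OF i'(1)] \<open>odd n\<^sub>2\<close> by auto
    then obtain l where "i' - n\<^sub>2 = 2 * l" ..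
    then have "\<bar>i\<bar>\<^sup>2 - n\<^sub>1\<^sup>2 = 2 * w * (2 * l)"
      using i'(2) n1 by (simp add: algebra_simps)
    then have "w * (l - j * (m + 1)) = j * (j + 1)"
      unfolding j(1) by (simp add: n1w power2_eq_square algebra_simps)
    moreover define f where "f = l - j * (m + 1)"
    ultimately have wf: "w * f = j * (j + 1)"
      by simp
    \<comment> \<open>As \<open>w = m * (m + 1)\<close> divides \<open>j * (j + 1)\<close> and
      \<open>j\<close> is at most \<open>m\<close>, only the two ends survive.\<close>
    have "j = 0 \<or> j = m"
    proof (rule ccontr)
      assume neg: "\<not> (j = 0 \<or> j = m)"
      then have "j * (j + 1) < m * (m + 1)"
        using j by (intro mult_strict_mono) auto
      then have "w * f < w * 1"
        using wf by (simp add: w_def)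
      moreover have "w * 0 < w * f"
        using wf neg j by simp
      ultimately have "0 < f" "f < 1"
        using w m by (simp_all only: mult_less_cancel_left_pos)
      then show False
        by simp
    qed
    with j show ?thesis
      by auto
  qed
  have n2: "n\<^sub>2\<^sup>2 + a = - (2 * w * (n\<^sub>1 + 2 * m))"
    by (simp add: a_def)
  have neg: "\<bar>i\<bar> \<le> n\<^sub>2 + 2 * m + 6"
    if i: "i \<in> ?N" and i': "i' \<in> ?N" "\<bar>i\<bar>\<^sup>2 + a = 2 * w * i'" "i' < 0" for i i'
  proof -
    have "w * i' \<le> w * - n\<^sub>2"
      by (rule mult_left_mono) (use ge[OF i'(1)] i'(3) w m in auto)
    \<comment> \<open>The offset is least possible: with \<open>2 * m + 6\<close> the cubic terms
      cancel and the difference \<open>- 12 * m^2 + 4 * m + 24\<close> is negative.\<close>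
    moreover have "(n\<^sub>2 + 2 * m + 7)\<^sup>2 + a + 2 * (w * n\<^sub>2) = 2 * (m\<^sup>2 * (m - 6)) + 6 * m + 35"
      by (simp add: a_def n\<^sub>1_def n\<^sub>2_def w_def power2_eq_square power3_eq_cube algebra_simps)
    moreover have "0 \<le> m\<^sup>2 * (m - 6)"
      using m by simp
    ultimately have "\<bar>i\<bar>\<^sup>2 < (n\<^sub>2 + 2 * m + 7)\<^sup>2"
      using i'(2) m unfolding mult.assoc by linarith
    then have "\<bar>i\<bar> < n\<^sub>2 + 2 * m + 7"
      by (rule power2_less_imp_less) (use n2_pos w m in auto)
    then show ?thesis
      by simp
  qed
  have gap: "\<bar>i\<bar> \<le> n\<^sub>2 + 2 * m + 6 \<or> n\<^sub>1 \<le> \<bar>i\<bar>" if i: "i \<in> ?N" for i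
  proof -
    obtain i' where i': "i' \<in> ?N" "\<bar>i\<bar>\<^sup>2 + a = 2 * w * i'"
      using step[OF i] by blast
    then show ?thesis
      using pos[OF i i'] neg[OF i i'] m by (cases "i' < 0") auto
  qed
  have neg': "\<bar>i\<bar> = n\<^sub>2 \<or> \<bar>i\<bar> = n\<^sub>2 + 2 \<and> - i' = n\<^sub>1 + 2"
    if i: "i \<in> ?N" and i': "i' \<in> ?N" "\<bar>i\<bar>\<^sup>2 + a = 2 * w * i'" "i' < 0" for i i'
  proof -
    have "even (\<bar>i\<bar> - n\<^sub>2)"
      using step[OF i] \<open>odd n\<^sub>2\<close> by auto
    then obtain j where "\<bar>i\<bar> - n\<^sub>2 = 2 * j" ..
    then have j: "\<bar>i\<bar> = n\<^sub>2 + 2 * j" "0 \<le> j" "j \<le> m + 3"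
      using neg[OF i i'] ge[OF i] by auto
    \<comment> \<open>Chosen so that reducing with \<open>n\<^sub>2 = w * (m - 1) - 1\<close> leaves
      \<open>w * e = 2 * j * (j - 1)\<close>; the size of \<open>j\<close> then confines
      \<open>e\<close> to 0, 1, 2, 3.\<close>
    define e where "e = i' + (n\<^sub>1 + 2 * m) - 2 * j * (m - 1)"
    have "\<bar>i\<bar>\<^sup>2 - n\<^sub>2\<^sup>2 = 2 * w * (i' + (n\<^sub>1 + 2 * m))"
      using i'(2) n2 by (simp add: algebra_simps)
    then have we: "w * e = 2 * (j * (j - 1))"
      unfolding j(1) e_def by (simp add: n2w power2_eq_square algebra_simps)
    have "j * (j - 1) \<ge> 0"
      using j(2) by (cases "j = 0") auto
    then have "w * e \<ge> 0"
      using we by simp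
    then have "e \<ge> 0"
      using w m by (simp add: zero_le_mult_iff)
    have "j * (j - 1) \<le> (m + 3) * (m + 2)"
      using j m by (cases "j = 0") (auto intro!: mult_mono)
    also have "\<dots> < 2 * w"
      unfolding w_def ring_distribs using \<open>10 * m \<le> m * m\<close> m by linarith
    finally have "w * e < w * 4"
      using we by simp
    then have "e < 4"
      using w m by (simp only: mult_less_cancel_left_pos)
    have "\<bar>i'\<bar> = n\<^sub>1 + 2 * m - 2 * j * (m - 1) - e"
      using i'(3) by (simp add: e_def)
    \<comment> \<open>The image must avoid the gap between the two intervals, which pushes
      \<open>j\<close> to either end of its range.\<close>
    then consider "2 * j * (m - 1) + e \<le> 2 * m" | "2 * j * (m - 1) + e \<ge> 2 * m\<^sup>2 + 2 * m - 4"
      using gap[OF i'(1)] by (auto simp: n\<^sub>1_def)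
    then show ?thesis
    proof cases
      case 1
      have "(m - 1) * j < (m - 1) * 2"
        using 1 \<open>e \<ge> 0\<close> m by (simp add: algebra_simps)
      then have "j < 2"
        using m by (simp only: mult_less_cancel_left_pos)
      then have "j = 0 \<or> j = 1"
        using j(2) by linarith
      then show ?thesis
        using j(1) we e_def w m by auto
    next
      case 2
      have "(m - 1) * (m + 1) < (m - 1) * j"
        using 2 \<open>e < 4\<close> m by (simp add: power2_eq_square algebra_simps)
      then have "m + 1 < j"
        using m by (simp only: mult_less_cancel_left_pos)
      \<comment> \<open>For both values \<open>2 * j * (j - 1)\<close> is \<open>2 * w\<close> plus
        a positive remainder below \<open>w\<close>, so it is no multiple of
        \<open>w\<close>.\<close>
      then have "j = m + 2 \<or> j = m + 3"
        using j(3) by linarith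
      then have "w * (e - 2) = 4 * (m + 1) \<or> w * (e - 2) = 8 * m + 12"
        using we by (auto simp: w_def algebra_simps)
      then have "4 * m + 4 \<le> w * (e - 2)" "w * (e - 2) \<le> 8 * m + 12"
        using m by auto
      then have "w * 0 < w * (e - 2)" "w * (e - 2) < w * 1"
        using w m by linarith+
      then have "0 < e - 2" "e - 2 < 1"
        using w m by (simp_all only: mult_less_cancel_left_pos)
      then show ?thesis
        by simp
    qed
  qed
  have classify: "\<bar>i\<bar> \<in> {n\<^sub>1, n\<^sub>1 + 2 * m, n\<^sub>2} \<or> \<bar>i\<bar> = n\<^sub>2 + 2 \<and> (\<exists>i' \<in> ?N. \<bar>i'\<bar> = n\<^sub>1 + 2)" if i: "i \<in> ?N" for i
  proof -
    obtain i' where i': "i' \<in> ?N" "\<bar>i\<bar>\<^sup>2 + a = 2 * w * i'"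
      using step[OF i] by blast
    then show ?thesis
      using pos[OF i i'] neg'[OF i i'] by (cases "i' < 0") (auto intro!: bexI[of _ i'])
  qed
  \<comment> \<open>The exceptional \<open>n\<^sub>2 + 2\<close> needs an image of absolute value
    \<open>n\<^sub>1 + 2\<close>, which the classification itself forbids.\<close>
  have "\<bar>i\<bar> \<noteq> n\<^sub>1 + 2" if i: "i \<in> ?N" for i
    using classify[OF i] \<open>n\<^sub>2 < n\<^sub>1\<close> m by auto
  then show ?thesis
    using classify[OF n] by auto
qed

lemma three_power_ge: "4 * int k + 15 \<le> 3 ^ k" if "k \<ge> 3"
  using that by (induction k rule: nat_induct_at_least) auto

section \<open>Explicit labellings and unbounded parameters for the six graphs\<close>

lemma infinite_4_11:
  "infinite {c. digraph_iso (with_proj (preper_digraph (quad_map c))) (with_proj graph_4_11)}"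
proof (rule infinite_params[where k\<^sub>0 = 3])
  fix k :: nat assume "k \<ge> 3"
  define b where "b = int k + 2"
  have "0 \<le> int k * int k"
    by simp
  then have b: "b \<ge> 3" "b - b\<^sup>2 < - int k * 1\<^sup>2"
    unfolding b_def power2_eq_square ring_distribs using \<open>k \<ge> 3\<close> by linarith+
  \<comment> \<open>The two fixed points sum to 1; primed vertices carry the negatives.\<close>
  define h where "h = (\<lambda>_. 0)(va := b, va' := - b, vb := 1 - b, vb' := b - 1)"
  have "digraph_iso (with_proj (preper_digraph (quad_map (of_int (b - b\<^sup>2) / (of_int 1)\<^sup>2)))) (with_proj graph_4_11)"
  proof (rule digraph_iso_preper_quad_map[of _ _ h])
    show "inj_on h (pverts graph_4_11)"
      using b by (auto simp: graph_4_11_def h_def)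
    show "u \<in> pverts graph_4_11 \<and> v \<in> pverts graph_4_11 \<and> (h u)\<^sup>2 + (b - b\<^sup>2) = 1 * h v"
      if "(u, v) \<in> parcs graph_4_11" for u v
      using that by (auto simp: graph_4_11_def h_def power2_eq_square algebra_simps)
    show "numers (b - b\<^sup>2) 1 \<subseteq> h ` pverts graph_4_11"
      using numers_4_11[OF b(1)] by (fastforce simp: graph_4_11_def h_def abs_if split: if_splits)
  qed (auto simp: graph_4_11_def)
  with b show "\<exists>a d. d > 0 \<and> a < - int k * d\<^sup>2 \<and>
      digraph_iso (with_proj (preper_digraph (quad_map (of_int a / (of_int d)\<^sup>2)))) (with_proj graph_4_11)"
    by (intro exI[of _ "b - b\<^sup>2"] exI[of _ 1]) auto
qed

lemma infinite_4_2:
  "infinite {c. digraph_iso (with_proj (preper_digraph (quad_map c))) (with_proj graph_4_2)}"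
proof (rule infinite_params[where k\<^sub>0 = 1])
  fix k :: nat assume "k \<ge> 1"
  define t where "t = int k"
  define a where "a = - (t\<^sup>2 + t + 1)"
  have "0 \<le> int k * int k"
    by simp
  then have t: "t \<ge> 1" "a < - int k * 1\<^sup>2"
    unfolding t_def a_def power2_eq_square using \<open>k \<ge> 1\<close> by linarith+
  define h where "h = (\<lambda>_. 0)(vx := t, vy := - t - 1, vx' := - t, vy' := t + 1)"
  have "digraph_iso (with_proj (preper_digraph (quad_map (of_int a / (of_int 1)\<^sup>2)))) (with_proj graph_4_2)"
  proof (rule digraph_iso_preper_quad_map[of _ _ h])
    show "inj_on h (pverts graph_4_2)"
      using t by (auto simp: graph_4_2_def h_def)
    show "u \<in> pverts graph_4_2 \<and> v \<in> pverts graph_4_2 \<and> (h u)\<^sup>2 + a = 1 * h v"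
      if "(u, v) \<in> parcs graph_4_2" for u v
      using that by (auto simp: graph_4_2_def h_def a_def power2_eq_square algebra_simps)
    show "numers a 1 \<subseteq> h ` pverts graph_4_2"
      using numers_4_2[OF t(1)] by (fastforce simp: graph_4_2_def h_def a_def abs_if split: if_splits)
  qed (auto simp: graph_4_2_def)
  with t show "\<exists>a d. d > 0 \<and> a < - int k * d\<^sup>2 \<and>
      digraph_iso (with_proj (preper_digraph (quad_map (of_int a / (of_int d)\<^sup>2)))) (with_proj graph_4_2)"
    by (intro exI[of _ a] exI[of _ 1]) auto
qed

lemma infinite_6_11:
  "infinite {c. digraph_iso (with_proj (preper_digraph (quad_map c))) (with_proj graph_6_11)}"
proof (rule infinite_params[where k\<^sub>0 = 3])
  fix k :: nat assume "k \<ge> 3"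
  define q :: int where "q = 3 ^ k"
  have q: "q \<ge> 4 * int k + 15"
    using three_power_ge[OF \<open>k \<ge> 3\<close>] by (simp add: q_def)
  have "even (q\<^sup>2 + 1)"
    by (simp add: q_def)
  then obtain B where "q\<^sup>2 + 1 = 2 * B" ..
  then have B: "2 * B = q\<^sup>2 + 1"
    by simp
  define a where "a = q * B - B\<^sup>2"
  have qB: "q + 2 < B"
  proof -
    have "9 * q \<le> q\<^sup>2"
      using q by (simp add: power2_eq_square)
    with B q show ?thesis
      by linarith
  qed
  have a: "a < - int k * q\<^sup>2"
  proof -
    have "4 * a = - ((q\<^sup>2 + 1) * (q - 1)\<^sup>2)"
    proof -
      have "4 * a = 2 * q * (2 * B) - (2 * B)\<^sup>2"
        by (simp add: a_def power2_eq_square algebra_simps)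
      then show ?thesis
        unfolding B by (simp add: power2_eq_square algebra_simps)
    qed
    moreover have "4 * int k * 1 \<le> (q - 1) * (q - 1)"
      by (rule mult_mono) (use q in auto)
    then have "q\<^sup>2 * (4 * int k) < (q\<^sup>2 + 1) * (q - 1)\<^sup>2"
      by (intro mult_less_le_imp_less) (use q \<open>k \<ge> 3\<close> in \<open>auto simp: power2_eq_square\<close>)
    ultimately show ?thesis
      by (simp add: algebra_simps)
  qed
  \<comment> \<open>From \<open>2 * B = q^2 + 1\<close> follows
    \<open>(B - 1)^2 + a = q * (B - q)\<close>, so \<open>B - 1\<close> and its negative are the
    preimages of \<open>va'\<close>.\<close>
  define h where "h = (\<lambda>_. 0)(va := q - B, va' := B - q, vb := B, vb' := - B, vu := B - 1, vu' := 1 - B)"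
  have "digraph_iso (with_proj (preper_digraph (quad_map (of_int a / (of_int q)\<^sup>2)))) (with_proj graph_6_11)"
  proof (rule digraph_iso_preper_quad_map[of _ _ h])
    show "inj_on h (pverts graph_6_11)"
      using qB q by (auto simp: graph_6_11_def h_def)
    show "u \<in> pverts graph_6_11 \<and> v \<in> pverts graph_6_11 \<and> (h u)\<^sup>2 + a = q * h v"
      if "(u, v) \<in> parcs graph_6_11" for u v
      using that B by (auto simp: graph_6_11_def h_def a_def power2_eq_square algebra_simps)
    show "numers a q \<subseteq> h ` pverts graph_6_11"
      using numers_6_11[OF q_def _ B] q
      by (fastforce simp: graph_6_11_def h_def a_def abs_if split: if_splits)
  qed (use q in \<open>auto simp: graph_6_11_def\<close>)
  with a q show "\<exists>a d. d > 0 \<and> a < - int k * d\<^sup>2 \<and>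
      digraph_iso (with_proj (preper_digraph (quad_map (of_int a / (of_int d)\<^sup>2)))) (with_proj graph_6_11)"
    by (intro exI[of _ a] exI[of _ q]) auto
qed

lemma infinite_6_2:
  "infinite {c. digraph_iso (with_proj (preper_digraph (quad_map c))) (with_proj graph_6_2)}"
proof (rule infinite_params[where k\<^sub>0 = 3])
  fix k :: nat assume "k \<ge> 3"
  define q :: int where "q = 3 ^ k"
  have q: "q \<ge> 4 * int k + 15"
    using three_power_ge[OF \<open>k \<ge> 3\<close>] by (simp add: q_def)
  have "even (q\<^sup>2 - 1)"
    by (simp add: q_def)
  then obtain T where "q\<^sup>2 - 1 = 2 * T" ..
  then have T: "2 * T = q\<^sup>2 - 1"
    by simp
  define a where "a = - (q\<^sup>2 + q * T + T\<^sup>2)"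
  have "q * (4 * int k + 15) \<le> q * q"
    by (rule mult_left_mono) (use q in auto)
  then have "2 * (q * int k) + q < T"
    using T q by (simp add: power2_eq_square algebra_simps)
  moreover have "0 \<le> q * int k"
    using q by simp
  ultimately have qT: "q * int k \<le> T" "q < T"
    using q by linarith+
  have a: "a < - int k * q\<^sup>2"
  proof -
    have "q * (q * int k) \<le> q * T"
      by (rule mult_left_mono) (use qT q in auto)
    moreover have "q\<^sup>2 > 0"
      using q by simp
    ultimately show ?thesis
      by (simp add: a_def power2_eq_square algebra_simps) (smt (verit) mult_nonneg_nonneg zero_le_square)
  qed
  \<comment> \<open>From \<open>2 * T = q^2 - 1\<close> follows
    \<open>(T + 1)^2 + a = q * (- T)\<close>, which gives the preimages of
    \<open>vx'\<close>.\<close>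
  define h where "h = (\<lambda>_. 0)(vx := T, vy := - T - q, vx' := - T, vy' := T + q, vu := T + 1, vu' := - T - 1)"
  have "digraph_iso (with_proj (preper_digraph (quad_map (of_int a / (of_int q)\<^sup>2)))) (with_proj graph_6_2)"
  proof (rule digraph_iso_preper_quad_map[of _ _ h])
    show "inj_on h (pverts graph_6_2)"
      using qT q by (auto simp: graph_6_2_def h_def)
    show "u \<in> pverts graph_6_2 \<and> v \<in> pverts graph_6_2 \<and> (h u)\<^sup>2 + a = q * h v"
      if "(u, v) \<in> parcs graph_6_2" for u v
      using that T by (auto simp: graph_6_2_def h_def a_def power2_eq_square algebra_simps)
    show "numers a q \<subseteq> h ` pverts graph_6_2"
      using numers_6_2[OF q_def _ T] q
      by (fastforce simp: graph_6_2_def h_def a_def abs_if split: if_splits)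
  qed (use q in \<open>auto simp: graph_6_2_def\<close>)
  with a q show "\<exists>a d. d > 0 \<and> a < - int k * d\<^sup>2 \<and>
      digraph_iso (with_proj (preper_digraph (quad_map (of_int a / (of_int d)\<^sup>2)))) (with_proj graph_6_2)"
    by (intro exI[of _ a] exI[of _ q]) auto
qed

lemma infinite_8_211:
  "infinite {c. digraph_iso (with_proj (preper_digraph (quad_map c))) (with_proj graph_8_211)}"
proof (rule infinite_params[where k\<^sub>0 = 3])
  fix k :: nat assume "k \<ge> 3"
  define q :: int where "q = 3 ^ k"
  have q: "q \<ge> 4 * int k + 15"
    using three_power_ge[OF \<open>k \<ge> 3\<close>] by (simp add: q_def)
  define B where "B = q\<^sup>2 + q + 1"
  define a where "a = 2 * q * B - B\<^sup>2"
  have qB: "2 * q + 2 < B"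
  proof -
    have "9 * q \<le> q\<^sup>2"
      using q by (simp add: power2_eq_square)
    then show ?thesis
      unfolding B_def using q by linarith
  qed
  have a: "a < - int k * (2 * q)\<^sup>2"
  proof -
    have "4 * int k * 1 \<le> q * q"
      by (rule mult_mono) (use q in auto)
    then have "q\<^sup>2 * (4 * int k) \<le> q\<^sup>2 * q\<^sup>2"
      by (intro mult_left_mono) (auto simp: power2_eq_square)
    moreover have "a = - (q\<^sup>2 * q\<^sup>2 + q\<^sup>2 + 1)"
      by (simp add: a_def B_def power2_eq_square algebra_simps)
    ultimately show ?thesis
      by (simp add: algebra_simps) (smt (verit) zero_le_power2)
  qed
  \<comment> \<open>Numerators of the fixed points sum to \<open>2 * q\<close>, those of the 2-cycle
    to \<open>- 2 * q\<close>.\<close>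
  define h where "h = (\<lambda>_. 0)(va := B, va' := - B, vb := 2 * q - B, vb' := B - 2 * q,
    vx := B - 2 - 2 * q, vy := 2 - B, vx' := 2 + 2 * q - B, vy' := B - 2)"
  note graph_defs = graph_8_211_def graph_4_11_def graph_4_2_def
  have "digraph_iso (with_proj (preper_digraph (quad_map (of_int a / (of_int (2 * q))\<^sup>2)))) (with_proj graph_8_211)"
  proof (rule digraph_iso_preper_quad_map[of _ _ h])
    show "inj_on h (pverts graph_8_211)"
      using qB q by (auto simp: graph_defs h_def)
    show "u \<in> pverts graph_8_211 \<and> v \<in> pverts graph_8_211 \<and> (h u)\<^sup>2 + a = 2 * q * h v"
      if "(u, v) \<in> parcs graph_8_211" for u v
      using that by (auto simp: graph_defs h_def a_def B_def power2_eq_square algebra_simps)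
    show "numers a (2 * q) \<subseteq> h ` pverts graph_8_211"
      using numers_8_211[OF q_def _ B_def] q
      by (fastforce simp: graph_defs h_def a_def abs_if split: if_splits)
  qed (use q in \<open>auto simp: graph_defs\<close>)
  with a q show "\<exists>a d. d > 0 \<and> a < - int k * d\<^sup>2 \<and>
      digraph_iso (with_proj (preper_digraph (quad_map (of_int a / (of_int d)\<^sup>2)))) (with_proj graph_8_211)"
    by (intro exI[of _ a] exI[of _ "2 * q"]) auto
qed

lemma infinite_6_3:
  "infinite {c. digraph_iso (with_proj (preper_digraph (quad_map c))) (with_proj graph_6_3)}"
proof (rule infinite_params[where k\<^sub>0 = 10])
  fix k :: nat assume "k \<ge> 10"
  define m w n\<^sub>2 n\<^sub>1 a where "m = int k" and "w = m * (m + 1)" and "n\<^sub>2 = m ^ 3 - m - 1"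
    and "n\<^sub>1 = n\<^sub>2 + 2 * m\<^sup>2 + 2 * m + 2" and "a = - (2 * w * (n\<^sub>1 + 2 * m) + n\<^sub>2\<^sup>2)"
  note defs = a_def n\<^sub>1_def n\<^sub>2_def w_def
  have m: "m \<ge> 10"
    using \<open>k \<ge> 10\<close> by (simp add: m_def)
  have "10 * 1 \<le> m * m"
    by (rule mult_mono) (use m in auto)
  then have "m * 10 \<le> m * (m * m)"
    by (intro mult_left_mono) (use m in auto)
  then have n2: "n\<^sub>2 > 0"
    unfolding n\<^sub>2_def power3_eq_cube mult.assoc using m by linarith
  have n21: "n\<^sub>2 < n\<^sub>1"
    unfolding n\<^sub>1_def using m zero_le_power2[of m] by linarith
  have w: "w > 0"
    using m by (simp add: w_def)
  have a: "a < - int k * (2 * w)\<^sup>2"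
  proof -
    have "- a = (m * m) * w\<^sup>2 + 3 * m ^ 4 + 8 * m ^ 3 + 9 * m\<^sup>2 + 4 * m + 1"
      by (simp add: defs power2_eq_square power3_eq_cube power4_eq_xxxx algebra_simps)
    moreover have "0 \<le> m ^ 4" "0 \<le> m ^ 3" "0 \<le> m\<^sup>2"
      using m by simp_all
    \<comment> \<open>The leading term of \<open>- a\<close> already dominates, as \<open>m\<close>
      is at least 4.\<close>
    moreover have "(m * 4) * w\<^sup>2 \<le> (m * m) * w\<^sup>2"
      by (intro mult_right_mono mult_left_mono) (use m in auto)
    moreover have "- m * (2 * w)\<^sup>2 = - ((m * 4) * w\<^sup>2)"
      by (simp add: power_mult_distrib)
    ultimately show ?thesis
      unfolding m_def[symmetric] using m by linarith
  qed
  define h where "h = (\<lambda>_. 0)(vx := n\<^sub>1, vy := n\<^sub>2, vz := - n\<^sub>1 - 2 * m,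
    vx' := - n\<^sub>1, vy' := - n\<^sub>2, vz' := n\<^sub>1 + 2 * m)"
  have "digraph_iso (with_proj (preper_digraph (quad_map (of_int a / (of_int (2 * w))\<^sup>2)))) (with_proj graph_6_3)"
  proof (rule digraph_iso_preper_quad_map[of _ _ h])
    show "inj_on h (pverts graph_6_3)"
      using n2 n21 m by (auto simp: graph_6_3_def h_def)
    show "u \<in> pverts graph_6_3 \<and> v \<in> pverts graph_6_3 \<and> (h u)\<^sup>2 + a = 2 * w * h v"
      if "(u, v) \<in> parcs graph_6_3" for u v
      using that by (auto simp: graph_6_3_def h_def defs power2_eq_square power3_eq_cube algebra_simps)
    show "numers a (2 * w) \<subseteq> h ` pverts graph_6_3"
      using numers_6_3[OF m, folded n\<^sub>2_def w_def, folded n\<^sub>1_def, folded a_def]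
      by (fastforce simp: graph_6_3_def h_def abs_if split: if_splits)
  qed (use w in \<open>auto simp: graph_6_3_def\<close>)
  with a w show "\<exists>a d. d > 0 \<and> a < - int k * d\<^sup>2 \<and>
      digraph_iso (with_proj (preper_digraph (quad_map (of_int a / (of_int d)\<^sup>2)))) (with_proj graph_6_3)"
    by (intro exI[of _ a] exI[of _ "2 * w"]) auto
qed

theorem theorem1p1:
  shows "\<forall>G \<in> {graph_4_11, graph_4_2, graph_6_11, graph_6_2, graph_6_3, graph_8_211}.
    infinite {c :: rat. digraph_iso (with_proj (preper_digraph (quad_map c))) (with_proj G)}"
  using infinite_4_11 infinite_4_2 infinite_6_11 infinite_6_2 infinite_6_3 infinite_8_211 by simp

end
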